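(* Let $(L_n)_{n\in\mathbb Z}$ be a sequence of Markov operators on $(B_s,\|\cdot\|_s)\subset(B_w,\|\cdot\|_w)$ such that: (a) $\|L_n\mu\|_w\le\|\mu\|_w$ for all $n\in\mathbb Z$, $\mu\in B_w$; (b) (strong exponential memory loss) there are $C_0\ge1$ and $\gamma>0$ with $\|L_{j+k-1}\circ\cdots\circ L_j\,v\|_s\le C_0e^{-\gamma k}\|v\|_s$ for all $j\in\mathbb Z$, $k\ge1$, $v\in V_s$; (c) (uniform Lasota--Yorke inequality) there are constants $\lambda\in[0,1)$ and $B\ge0$ with $\|L_nf\|_s\le\lambda\|f\|_s+B\|f\|_w$ for all $n\in\mathbb Z$, $f\in B_s$. Let $(\pi_m)_{m\ge1}$ be a family of finite-rank projections on $B_w$ such that for every $m\ge 1$ $$\|\pi_mf\|_w\le\|f\|_w\ \ (f\in B_w),\qquad \|\pi_mf\|_s\le\|f\|_s\ \ (f\in B_s),$$ and such that there is a sequence $\delta_m\to0$ with $\|\pi_mf-f\|_w\le\delta_m\|f\|_s$ for all $f\in B_s$ and $m\ge1$. Put $M_n^{(m)}:=\pi_mL_n\pi_m$ for $n\in\mathbb Z$. Let $\boldsymbol h=(h_n)_{n\in\mathbb Z}\in\mathcal P_s^{\mathbb Z}$ be the equivariant family of $(L_n)_{n\in\mathbb Z}$ and, for each $m$, let $\boldsymbol h^{(m)}=(h_n^{(m)})_{n\in\mathbb Z}\in\mathcal P_s^{\mathbb Z}$ be an equivariant family of $(M_n^{(m)})_{n\in\mathbb Z}$. Then there exist $m_0\in\mathbb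 N$ and $C>0$ such that for every $m\ge m_0$, $$\sup_{n\in\mathbb Z}\|h_n^{(m)}-h_n\|_w\le C\,\delta_m\,|\log\delta_m| .$$
   Context: $(X,\mathcal A)$ is a measurable space; $B_s\subset B_w$ are normed linear spaces of finite signed measures on $X$, with $\|\mu\|_w\le\|\mu\|_s$ for all $\mu\in B_s$. $V_s:=\{\mu\in B_s:\mu(X)=0\}$ and $\mathcal P_s:=\{\mu\in B_s:\mu\ge0,\ \mu(X)=1\}$. A Markov operator is a linear map $B_w\to B_w$ that maps $B_s$ into $B_s$, preserves positivity and preserves total mass $\mu\mapsto\mu(X)$. A projection is a linear map $\pi$ with $\pi^2=\pi$; here $\pi_m$ maps $B_s$ into $B_s$. An equivariant family of a sequence of operators $(A_n)_{n\in\mathbb Z}$ is a sequence $(\mu_n)_{n\in\mathbb Z}\in\mathcal P_s^{\mathbb Z}$ with $\sup_n\|\mu_n\|_s<\infty$ and $\mu_{n+1}=A_n\mu_n$ for all $n\in\mathbb Z$. Convention: $0\,|\log 0|=0$. *)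

theory Defs
  imports "HOL-Analysis.Analysis" "HOL-Library.Function_Algebras"
begin

(* Together with the pointwise operations of Function_Algebras this makes functions into a real
   vector space, so that subspace, span etc. apply to spaces of set functions. *)

instantiation "fun" :: (type, real_vector) real_vector
begin

definition scaleR_fun :: "real \<Rightarrow> ('a \<Rightarrow> 'b) \<Rightarrow> 'a \<Rightarrow> 'b"
  where "scaleR_fun c f = (\<lambda>x. c *\<^sub>R f x)"

instance
  by standard (simp_all add: scaleR_fun_def fun_eq_iff algebra_simps)

end

(* Only space M and sets M are used: the measure carried by M is irrelevant. Signed measures
   vanish outside sets M by convention, so that two of them are equal as functions iff they agree
   on all measurable sets. *)

definition finite_signed_measures :: "'a measure \<Rightarrow> ('a set \<Rightarrow> real) set"
  where "finite_signed_measures M =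
    {\<mu>. \<mu> {} = 0 \<and>
        (\<forall>A :: nat \<Rightarrow> 'a set. range A \<subseteq> sets M \<longrightarrow> disjoint_family A \<longrightarrow>
           (\<lambda>i. \<mu> (A i)) sums \<mu> (\<Union>i. A i)) \<and>
        (\<forall>A. A \<notin> sets M \<longrightarrow> \<mu> A = 0)}"

definition nonneg_measure :: "'a measure \<Rightarrow> ('a set \<Rightarrow> real) \<Rightarrow> bool"
  where "nonneg_measure M \<mu> \<longleftrightarrow> (\<forall>A\<in>sets M. 0 \<le> \<mu> A)"

definition norm_on :: "'b::real_vector set \<Rightarrow> ('b \<Rightarrow> real) \<Rightarrow> bool"
  where "norm_on V N \<longleftrightarrow>
    (\<forall>x\<in>V. 0 \<le> N x) \<and>
    (\<forall>x\<in>V. N x = 0 \<longleftrightarrow> x = 0) \<and>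
    (\<forall>c. \<forall>x\<in>V. N (c *\<^sub>R x) = \<bar>c\<bar> * N x) \<and>
    (\<forall>x\<in>V. \<forall>y\<in>V. N (x + y) \<le> N x + N y)"

definition normed_measure_space ::
    "'a measure \<Rightarrow> ('a set \<Rightarrow> real) set \<Rightarrow> (('a set \<Rightarrow> real) \<Rightarrow> real) \<Rightarrow> bool"
  where "normed_measure_space M B N \<longleftrightarrow>
    B \<subseteq> finite_signed_measures M \<and> subspace B \<and> norm_on B N"

definition zero_mass :: "'a measure \<Rightarrow> ('a set \<Rightarrow> real) set \<Rightarrow> ('a set \<Rightarrow> real) set"
  where "zero_mass M B = {\<mu> \<in> B. \<mu> (space M) = 0}"

definition prob_measures :: "'a measure \<Rightarrow> ('a set \<Rightarrow> real) set \<Rightarrow> ('a set \<Rightarrow> real) set"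
  where "prob_measures M B = {\<mu> \<in> B. nonneg_measure M \<mu> \<and> \<mu> (space M) = 1}"

definition linear_operator_on :: "'b::real_vector set \<Rightarrow> ('b \<Rightarrow> 'b) \<Rightarrow> bool"
  where "linear_operator_on V T \<longleftrightarrow>
    T ` V \<subseteq> V \<and>
    (\<forall>x\<in>V. \<forall>y\<in>V. T (x + y) = T x + T y) \<and>
    (\<forall>c. \<forall>x\<in>V. T (c *\<^sub>R x) = c *\<^sub>R T x)"

definition markov_operator ::
    "'a measure \<Rightarrow> ('a set \<Rightarrow> real) set \<Rightarrow> ('a set \<Rightarrow> real) set \<Rightarrow>
     (('a set \<Rightarrow> real) \<Rightarrow> ('a set \<Rightarrow> real)) \<Rightarrow> bool"
  where "markov_operator M Bs Bw T \<longleftrightarrow>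
    linear_operator_on Bw T \<and>
    T ` Bs \<subseteq> Bs \<and>
    (\<forall>\<mu>\<in>Bw. nonneg_measure M \<mu> \<longrightarrow> nonneg_measure M (T \<mu>)) \<and>
    (\<forall>\<mu>\<in>Bw. T \<mu> (space M) = \<mu> (space M))"

definition projection_on :: "'b::real_vector set \<Rightarrow> ('b \<Rightarrow> 'b) \<Rightarrow> bool"
  where "projection_on V P \<longleftrightarrow> linear_operator_on V P \<and> (\<forall>x\<in>V. P (P x) = P x)"

definition finite_rank_on :: "'b::real_vector set \<Rightarrow> ('b \<Rightarrow> 'b) \<Rightarrow> bool"
  where "finite_rank_on V T \<longleftrightarrow> (\<exists>F. finite F \<and> T ` V \<subseteq> span F)"

(* cocycle A j k = A (j + k - 1) o ... o A j *)

primrec cocycle :: "(int \<Rightarrow> 'b \<Rightarrow> 'b) \<Rightarrow> int \<Rightarrow> nat \<Rightarrow> 'b \<Rightarrow> 'b"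
  where
    "cocycle A j 0 = id"
  | "cocycle A j (Suc k) = A (j + int k) \<circ> cocycle A j k"

definition equivariant_family ::
    "'a measure \<Rightarrow> ('a set \<Rightarrow> real) set \<Rightarrow> (('a set \<Rightarrow> real) \<Rightarrow> real) \<Rightarrow>
     (int \<Rightarrow> ('a set \<Rightarrow> real) \<Rightarrow> ('a set \<Rightarrow> real)) \<Rightarrow> (int \<Rightarrow> 'a set \<Rightarrow> real) \<Rightarrow> bool"
  where "equivariant_family M Bs Ns A \<mu> \<longleftrightarrow>
    (\<forall>n. \<mu> n \<in> prob_measures M Bs) \<and>
    bdd_above (range (\<lambda>n. Ns (\<mu> n))) \<and>
    (\<forall>n. \<mu> (n + 1) = A n (\<mu> n))"

end

theory Submission
  imports Defs "HOL-Real_Asymp.Real_Asymp"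
begin

text \<open>Both families are compared through the orbits of \<open>L\<close>: \<open>h\<close> is an exact orbit, and
  \<open>hm m\<close> is a pseudo-orbit whose one-step error has weak norm \<open>O(\<delta>\<^sub>m)\<close>. Weak contraction makes
  these errors add up, so after \<open>k\<close> steps the weak distance is at most \<open>O(k \<delta>\<^sub>m)\<close> plus the
  exponentially small memory of the initial difference. For one fixed large \<open>k\<close>, this estimate and
  the Lasota--Yorke inequality bound the strong norms of \<open>hm m\<close> uniformly in \<open>m\<close>; then
  \<open>k \<approx> \<bar>ln \<delta>\<^sub>m\<bar> / \<gamma>\<close> gives the rate.\<close>

section \<open>Norms and linear maps on a subspace\<close>

lemma norm_on_nonneg: "norm_on V N \<Longrightarrow> x \<in> V \<Longrightarrow> 0 \<le> N x"
  unfolding norm_on_def by (elim conjE) (erule bspec)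

lemma norm_on_eq_0_iff: "norm_on V N \<Longrightarrow> x \<in> V \<Longrightarrow> N x = 0 \<longleftrightarrow> x = 0"
  unfolding norm_on_def by (elim conjE) (erule bspec)

lemma norm_on_triangle:
  "norm_on V N \<Longrightarrow> x \<in> V \<Longrightarrow> y \<in> V \<Longrightarrow> N (x + y) \<le> N x + N y"
  unfolding norm_on_def by simp

lemma norm_on_diff_le:
  assumes "norm_on V N" "subspace V" "x \<in> V" "y \<in> V"
  shows "N (x - y) \<le> N x + N y"
proof -
  have "- y \<in> V" using assms by (simp add: subspace_neg)
  moreover have "N (- y) = N y"
    using assms(1,4) unfolding norm_on_def by (metis abs_minus_cancel abs_one mult_1 scaleR_minus1_left)
  ultimately show ?thesis
    using assms(1,3) unfolding norm_on_def by (metis add_uminus_conv_diff)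
qed

lemma linear_operator_on_diff:
  assumes "linear_operator_on V T" "subspace V" "x \<in> V" "y \<in> V"
  shows "T (x - y) = T x - T y"
proof -
  have "T (- y) = - T y"
    using assms(1,4) unfolding linear_operator_on_def by (metis scaleR_minus1_left)
  then show ?thesis
    using assms unfolding linear_operator_on_def
    by (metis add_uminus_conv_diff subspace_neg)
qed

section \<open>Orbits and pseudo-orbits of a sequence of linear maps\<close>

lemma linear_operator_on_cocycle:
  assumes "\<And>n. linear_operator_on V (A n)"
  shows "linear_operator_on V (cocycle A j k)"
proof (induction k)
  case 0
  show ?case by (simp add: linear_operator_on_def)
next
  case (Suc k)
  then show ?case
    using assms[of "j + int k"] unfolding linear_operator_on_def
    by (simp add: image_subset_iff)
qed

lemma cocycle_orbit:
  assumes "\<And>n. h (n + 1) = A n (h n)"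
  shows "cocycle A j k (h j) = h (j + int k)"
proof (induction k)
  case (Suc k)
  then show ?case using assms[of "j + int k"] by (simp add: ac_simps)
qed simp

text \<open>Each step adds a fresh error of at most \<open>e\<close> to the image of the error made
  so far, and contraction keeps that image from growing. Hence the errors only add up.\<close>

lemma cocycle_pseudo_orbit:
  assumes V: "subspace V" and N: "norm_on V N"
    and lin: "\<And>n. linear_operator_on V (A n)"
    and contr: "\<And>n x. x \<in> V \<Longrightarrow> N (A n x) \<le> N x"
    and g: "\<And>n. g n \<in> V"
    and err: "\<And>n. N (g (n + 1) - A n (g n)) \<le> e"
  shows "N (g (j + int k) - cocycle A j k (g j)) \<le> real k * e"
proof (induction k)
  case 0
  have "N 0 = 0" using norm_on_eq_0_iff[OF N subspace_0[OF V]] by simp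
  then show ?case by simp
next
  case (Suc k)
  let ?n = "j + int k" and ?c = "cocycle A j k (g j)"
  have c: "?c \<in> V"
    using linear_operator_on_cocycle[of V A j k] lin g[of j]
    unfolding linear_operator_on_def by blast
  have Ag: "A ?n (g ?n) \<in> V"
    using lin[of ?n] g[of ?n] unfolding linear_operator_on_def by blast
  have d: "g ?n - ?c \<in> V" using V g c by (simp add: subspace_diff)
  then have Ad: "A ?n (g ?n - ?c) \<in> V"
    using lin[of ?n] unfolding linear_operator_on_def by blast
  have "g (j + int (Suc k)) - cocycle A j (Suc k) (g j)
      = (g (?n + 1) - A ?n (g ?n)) + A ?n (g ?n - ?c)"
    using linear_operator_on_diff[OF lin V g c, of ?n] by (simp add: ac_simps)
  then have "N (g (j + int (Suc k)) - cocycle A j (Suc k) (g j))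
      \<le> N (g (?n + 1) - A ?n (g ?n)) + N (A ?n (g ?n - ?c))"
    using norm_on_triangle[OF N subspace_diff[OF V g Ag] Ad, of "?n + 1"] by simp
  also have "\<dots> \<le> e + real k * e"
    using err[of ?n] contr[OF d, of ?n] Suc.IH by linarith
  finally show ?case by (simp add: algebra_simps)
qed

text \<open>Taking \<open>k\<close> close to \<open>- ln d / c\<close> balances the two terms: the
  exponential drops to at most \<open>d\<close>, while the linear term is of order
  \<open>d * \<bar>ln d\<bar>\<close>. The condition \<open>d \<le> exp (- 1)\<close> gives
  \<open>\<bar>ln d\<bar> \<ge> 1\<close>, which absorbs the lower-order contributions.\<close>

lemma le_mult_abs_ln:
  fixes a b c d x :: real
  assumes c: "0 < c" and a: "0 \<le> a" and b: "0 \<le> b"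
    and d: "0 \<le> d" "d \<le> exp (- 1)"
    and bound: "\<And>k::nat. 1 \<le> k \<Longrightarrow> x \<le> real k * (d * a) + b * exp (- c * real k)"
  shows "x \<le> (a * (1 / c + 1) + b) * d * \<bar>ln d\<bar>"
proof (cases "d = 0")
  case True
  \<comment> \<open>No optimal \<open>k\<close> exists here: the claim is \<open>x \<le> 0\<close>,
    reached by letting \<open>k\<close> tend to infinity.\<close>
  have "(\<lambda>k. b * exp (- c * real k)) \<longlonglongrightarrow> 0"
    using c by real_asymp
  then have "x \<le> 0"
    by (rule LIMSEQ_le_const) (use bound True in auto)
  then show ?thesis using True by simp
next
  case False
  then have d_pos: "0 < d" using d by simp
  have ln: "ln d \<le> - 1" using ln_mono[OF d(2) d_pos] by simp
  \<comment> \<open>The least \<open>k\<close> with \<open>exp (- c * real k) \<le> d\<close>;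
    rounding up costs at most 1, which is bounded by \<open>- ln d\<close>.\<close>
  define k where "k = nat \<lceil>- ln d / c\<rceil>"
  have pos: "0 < - ln d / c" using ln c by (intro divide_pos_pos) auto
  then have k: "1 \<le> k" "- ln d / c \<le> real k" "real k \<le> - ln d / c + 1"
    unfolding k_def by linarith+
  have "exp (- c * real k) \<le> exp (ln d)"
    using k(2) c by (simp add: field_simps)
  also have "\<dots> \<le> d * - ln d"
    using mult_left_mono[of 1 "- ln d" d] d_pos ln by simp
  finally have 1: "b * exp (- c * real k) \<le> b * (d * - ln d)"
    using b by (rule mult_left_mono)
  have "real k \<le> (1 / c + 1) * - ln d"
    using k(3) ln by (simp add: algebra_simps)
  then have "real k * (d * a) \<le> (1 / c + 1) * - ln d * (d * a)"
    using a d by (intro mult_right_mono) auto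
  with 1 bound[OF k(1)] have "x \<le> (1 / c + 1) * - ln d * (d * a) + b * (d * - ln d)"
    by linarith
  then show ?thesis using ln by (simp add: algebra_simps)
qed

theorem proposition16:
  fixes M :: "'a measure"
    and Bs Bw :: "('a set \<Rightarrow> real) set"
    and Ns Nw :: "('a set \<Rightarrow> real) \<Rightarrow> real"
    and L :: "int \<Rightarrow> ('a set \<Rightarrow> real) \<Rightarrow> ('a set \<Rightarrow> real)"
    and \<pi> :: "nat \<Rightarrow> ('a set \<Rightarrow> real) \<Rightarrow> ('a set \<Rightarrow> real)"
    and C\<^sub>0 \<gamma> lam B :: real
    and \<delta> :: "nat \<Rightarrow> real"
    and h :: "int \<Rightarrow> 'a set \<Rightarrow> real"
    and hm :: "nat \<Rightarrow> int \<Rightarrow> 'a set \<Rightarrow> real"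
  assumes strong_space: "normed_measure_space M Bs Ns"
    and weak_space: "normed_measure_space M Bw Nw"
    and inclusion: "Bs \<subseteq> Bw"
    and weak_le_strong: "\<And>\<mu>. \<mu> \<in> Bs \<Longrightarrow> Nw \<mu> \<le> Ns \<mu>"
    and markov: "\<And>n. markov_operator M Bs Bw (L n)"
    and weak_contraction: "\<And>n \<mu>. \<mu> \<in> Bw \<Longrightarrow> Nw (L n \<mu>) \<le> Nw \<mu>"
    and C\<^sub>0_ge_1: "1 \<le> C\<^sub>0"
    and \<gamma>_pos: "0 < \<gamma>"
    and memory_loss:
      "\<And>j k v. 1 \<le> k \<Longrightarrow> v \<in> zero_mass M Bs \<Longrightarrow>
         Ns (cocycle L j k v) \<le> C\<^sub>0 * exp (- \<gamma> * real k) * Ns v"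
    and lam_nonneg: "0 \<le> lam"
    and lam_less_1: "lam < 1"
    and B_nonneg: "0 \<le> B"
    and lasota_yorke: "\<And>n f. f \<in> Bs \<Longrightarrow> Ns (L n f) \<le> lam * Ns f + B * Nw f"
    and projections: "\<And>m. 1 \<le> m \<Longrightarrow> projection_on Bw (\<pi> m)"
    and finite_rank: "\<And>m. 1 \<le> m \<Longrightarrow> finite_rank_on Bw (\<pi> m)"
    and projections_strong: "\<And>m. 1 \<le> m \<Longrightarrow> \<pi> m ` Bs \<subseteq> Bs"
    and projections_weak_contraction:
      "\<And>m f. 1 \<le> m \<Longrightarrow> f \<in> Bw \<Longrightarrow> Nw (\<pi> m f) \<le> Nw f"
    and projections_strong_contraction:
      "\<And>m f. 1 \<le> m \<Longrightarrow> f \<in> Bs \<Longrightarrow> Ns (\<pi> m f) \<le> Ns f"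
    and \<delta>_limit: "\<delta> \<longlonglongrightarrow> 0"
    and approximation:
      "\<And>m f. 1 \<le> m \<Longrightarrow> f \<in> Bs \<Longrightarrow> Nw (\<pi> m f - f) \<le> \<delta> m * Ns f"
    and equivariant: "equivariant_family M Bs Ns L h"
    and equivariant_approx:
      "\<And>m. 1 \<le> m \<Longrightarrow> equivariant_family M Bs Ns (\<lambda>n. \<pi> m \<circ> L n \<circ> \<pi> m) (hm m)"
  shows "\<exists>m\<^sub>0\<ge>1. \<exists>C>0. \<forall>m\<ge>m\<^sub>0.
           (SUP n. ereal (Nw (hm m n - h n))) \<le> ereal (C * \<delta> m * \<bar>ln (\<delta> m)\<bar>)"
proof -

  \<comment> \<open>Basic facts on the spaces, the operators and the two families\<close>
  have Vs: "subspace Bs" and Ns: "norm_on Bs Ns" and Vw: "subspace Bw" and Nw: "norm_on Bw Nw"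
    using strong_space weak_space unfolding normed_measure_space_def by auto
  have lin: "linear_operator_on Bw (L n)" and L_Bs: "f \<in> Bs \<Longrightarrow> L n f \<in> Bs" for n f
    using markov[of n] unfolding markov_operator_def by auto
  note h = equivariant[unfolded equivariant_family_def]
  have h_prob: "h n \<in> prob_measures M Bs" for n
    using h[THEN conjunct1] by (rule spec)
  have h_step: "h (n + 1) = L n (h n)" for n using h[THEN conjunct2, THEN conjunct2] by (rule spec)
  have h_Bs: "h n \<in> Bs" for n using h_prob unfolding prob_measures_def by auto
  have Ns_ge0: "0 \<le> Ns f" if "f \<in> Bs" for f using Ns that by (rule norm_on_nonneg)
  have Nw_ge0: "0 \<le> Nw f" if "f \<in> Bs" for f
    using Nw subsetD[OF inclusion that] by (rule norm_on_nonneg)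
  obtain H where H: "Ns (h n) \<le> H" for n
    using h[THEN conjunct2, THEN conjunct1] unfolding bdd_above_def by (metis rangeI)
  have H0: "0 \<le> H" using H[of 0] Ns_ge0[OF h_Bs[of 0]] by linarith

  \<comment> \<open>The sign of \<delta> comes from testing the approximation bound on
    \<open>h 0\<close>, which is nonzero because it has mass 1.\<close>
  have \<delta>_nonneg: "0 \<le> \<delta> m" if m: "1 \<le> m" for m
  proof -
    have "h 0 (space M) = 1" using h_prob[of 0] unfolding prob_measures_def by auto
    then have "h 0 \<noteq> 0" by auto
    then have "0 < Ns (h 0)"
      using norm_on_eq_0_iff[OF Ns h_Bs, of 0] Ns_ge0[OF h_Bs, of 0] by simp
    moreover have "0 \<le> \<delta> m * Ns (h 0)"
    proof -
      have "\<pi> m (h 0) \<in> Bs" using projections_strong[OF m] h_Bs[of 0] by (rule subsetD[OF _ imageI])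
      then have "0 \<le> Nw (\<pi> m (h 0) - h 0)" using h_Bs[of 0] Vs by (intro Nw_ge0 subspace_diff)
      also have "\<dots> \<le> \<delta> m * Ns (h 0)" using m h_Bs[of 0] by (rule approximation)
      finally show ?thesis .
    qed
    ultimately show ?thesis by (simp add: zero_le_mult_iff)
  qed

  note hm = equivariant_approx[unfolded equivariant_family_def comp_def]
  have hm_prob: "hm m n \<in> prob_measures M Bs" if "1 \<le> m" for m n
    using hm[OF that, THEN conjunct1] by (rule spec)
  have hm_bdd: "bdd_above (range (\<lambda>n. Ns (hm m n)))" if "1 \<le> m" for m
    using hm[OF that, THEN conjunct2, THEN conjunct1] .
  have hm_eq: "hm m (n + 1) = \<pi> m (L n (\<pi> m (hm m n)))" if "1 \<le> m" for m n
    using hm[OF that, THEN conjunct2, THEN conjunct2] by (rule spec)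
  have hm_Bs: "hm m n \<in> Bs" if "1 \<le> m" for m n
    using hm_prob[OF that] unfolding prob_measures_def by auto
  \<comment> \<open>Every \<open>hm m n\<close> lies in the range of \<open>\<pi> m\<close> and is
    fixed by it, so the inner projection drops out and only the outer one separates
    \<open>hm m\<close> from an orbit of \<open>L\<close>.\<close>
  have hm_step: "hm m (n + 1) = \<pi> m (L n (hm m n))" if m: "1 \<le> m" for m n
  proof -
    have "\<pi> m (hm m n) = hm m n"
    proof -
      let ?f = "L (n - 1) (\<pi> m (hm m (n - 1)))"
      have "?f \<in> Bw"
        by (rule subsetD[OF inclusion L_Bs[OF subsetD[OF projections_strong[OF m] imageI[OF hm_Bs[OF m]]]]])
      moreover have "hm m n = \<pi> m ?f" using hm_eq[OF m, of "n - 1"] by simp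
      ultimately show ?thesis using projections[OF m] unfolding projection_on_def by simp
    qed
    then show ?thesis using hm_eq[OF m] by simp
  qed

  \<comment> \<open>The strong bound \<open>S\<close> is left free because the estimate is used
    twice: first with a bound depending on \<open>m\<close>, then with a uniform one.\<close>
  have gap: "Nw (hm m n - h n) \<le> real k * (\<delta> m * ((lam + B) * S)) + C\<^sub>0 * (S + H) * exp (- \<gamma> * real k)"
    if m: "1 \<le> m" and k: "1 \<le> k" and S: "\<And>n. Ns (hm m n) \<le> S" for m k S n
  proof -
    \<comment> \<open>The comparison starts \<open>k\<close> steps in the past, so that the
      evolution ends at time \<open>n\<close>.\<close>
    define j where "j = n - int k"
    have jk: "j + int k = n" unfolding j_def by simp
    let ?g = "hm m"
    have g: "?g i \<in> Bs" "?g i \<in> Bw" "h i \<in> Bw" for i using hm_Bs[OF m] h_Bs inclusion by auto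
    \<comment> \<open>The one-step error is \<open>\<pi> m f - f\<close> with
      \<open>f = L i (?g i)\<close>, whose strong norm is controlled by Lasota--Yorke and the
      domination of \<open>Nw\<close> by \<open>Ns\<close>.\<close>
    have err: "Nw (?g (i + 1) - L i (?g i)) \<le> \<delta> m * ((lam + B) * S)" for i
    proof -
      have "Ns (L i (?g i)) \<le> lam * Ns (?g i) + B * Ns (?g i)"
        using lasota_yorke[OF g(1), of i i] mult_left_mono[OF weak_le_strong[OF g(1)] B_nonneg, of i]
        by linarith
      also have "\<dots> = (lam + B) * Ns (?g i)" by (simp add: algebra_simps)
      also have "\<dots> \<le> (lam + B) * S"
        using lam_nonneg B_nonneg S by (intro mult_left_mono) auto
      finally have "\<delta> m * Ns (L i (?g i)) \<le> \<delta> m * ((lam + B) * S)"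
        using \<delta>_nonneg[OF m] by (rule mult_left_mono)
      then show ?thesis
        using approximation[OF m L_Bs[OF g(1)], of i i] unfolding hm_step[OF m] by linarith
    qed
    have 1: "Nw (?g n - cocycle L j k (?g j)) \<le> real k * (\<delta> m * ((lam + B) * S))"
      using cocycle_pseudo_orbit[where A = L and g = ?g and j = j and k = k,
          OF Vw Nw lin weak_contraction g(2) err]
      unfolding jk .
    let ?v = "?g j - h j"
    \<comment> \<open>Both measures have mass 1, so memory loss applies to their difference.\<close>
    have v: "?v \<in> zero_mass M Bs"
      using hm_prob[OF m, of j] h_prob[of j] Vs
      unfolding prob_measures_def zero_mass_def by (auto simp: subspace_diff)
    have clin: "linear_operator_on Bw (cocycle L j k)"
      using lin by (rule linear_operator_on_cocycle)
    have c_Bs: "cocycle L j i f \<in> Bs" if "f \<in> Bs" for i f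
      using that by (induction i) (auto intro: L_Bs)
    have v_Bs: "?v \<in> Bs" using v unfolding zero_mass_def by simp
    have cv: "cocycle L j k ?v = cocycle L j k (?g j) - h n"
      using linear_operator_on_diff[OF clin Vw g(2) g(3), of j j] cocycle_orbit[where h = h and A = L and j = j and k = k, OF h_step]
      unfolding jk by (simp only:)
    have "Nw (cocycle L j k ?v) \<le> C\<^sub>0 * exp (- \<gamma> * real k) * Ns ?v"
      using weak_le_strong[OF c_Bs[OF v_Bs]] memory_loss[OF k v] by (rule order_trans)
    also have "\<dots> \<le> C\<^sub>0 * exp (- \<gamma> * real k) * (S + H)"
      using C\<^sub>0_ge_1 norm_on_diff_le[OF Ns Vs g(1) h_Bs, of j j] S[of j] H[of j]
      by (intro mult_left_mono) auto
    finally have 2: "Nw (cocycle L j k ?v) \<le> C\<^sub>0 * (S + H) * exp (- \<gamma> * real k)"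
      by (simp add: ac_simps)
    have split: "?g n - h n = (?g n - cocycle L j k (?g j)) + cocycle L j k ?v"
      unfolding cv by simp
    have "?g n - cocycle L j k (?g j) \<in> Bw" "cocycle L j k ?v \<in> Bw"
      using subspace_diff[OF Vs g(1) c_Bs[OF g(1)]] c_Bs[OF v_Bs] inclusion by auto
    then have "Nw (?g n - h n) \<le> Nw (?g n - cocycle L j k (?g j)) + Nw (cocycle L j k ?v)"
      unfolding split by (rule norm_on_triangle[OF Nw])
    with 1 2 show ?thesis by linarith
  qed

  \<comment> \<open>The solution of \<open>(1 - lam) / 2 * S = B * (H + C\<^sub>0 * H)\<close>:
    below, \<open>k\<close> and then \<open>m\<^sub>0\<close> are chosen so that two terms
    proportional to the unknown bound have coefficients below \<open>(1 - lam) / 4\<close>. The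
    order matters, since the accumulated error grows with \<open>k\<close>.\<close>
  define S where "S = 2 * B * (H + C\<^sub>0 * H) / (1 - lam)"
  have S0: "0 \<le> S" unfolding S_def using B_nonneg H0 C\<^sub>0_ge_1 lam_less_1 by simp
  have "(\<lambda>k. B * C\<^sub>0 * exp (- \<gamma> * real k)) \<longlonglongrightarrow> 0"
    using \<gamma>_pos by real_asymp
  then have "\<forall>\<^sub>F k in sequentially. B * C\<^sub>0 * exp (- \<gamma> * real k) < (1 - lam) / 4"
    by (rule order_tendstoD) (use lam_less_1 in simp)
  then have "\<forall>\<^sub>F k in sequentially. 1 \<le> k \<and> B * C\<^sub>0 * exp (- \<gamma> * real k) < (1 - lam) / 4"
    using eventually_ge_at_top by (rule eventually_conj[rotated])
  then obtain k where k: "1 \<le> k" "B * C\<^sub>0 * exp (- \<gamma> * real k) < (1 - lam) / 4"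
    using eventually_happens'[OF sequentially_bot] by blast
  have "(\<lambda>m. B * real k * (lam + B) * \<delta> m) \<longlonglongrightarrow> 0"
    using tendsto_mult_right_zero[OF \<delta>_limit] by blast
  then have "\<forall>\<^sub>F m in sequentially. B * real k * (lam + B) * \<delta> m < (1 - lam) / 4"
    by (rule order_tendstoD) (use lam_less_1 in simp)
  moreover have "\<forall>\<^sub>F m in sequentially. \<delta> m < exp (- 1)"
    using \<delta>_limit by (rule order_tendstoD) simp
  ultimately have "\<forall>\<^sub>F m in sequentially.
      1 \<le> m \<and> B * real k * (lam + B) * \<delta> m < (1 - lam) / 4 \<and> \<delta> m < exp (- 1)"
    using eventually_ge_at_top[of 1] by eventually_elim auto
  then obtain m\<^sub>0 where m\<^sub>0: "\<And>m. m\<^sub>0 \<le> m \<Longrightarrow>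
      1 \<le> m \<and> B * real k * (lam + B) * \<delta> m < (1 - lam) / 4 \<and> \<delta> m < exp (- 1)"
    unfolding eventually_sequentially by blast

  \<comment> \<open>Strong bound on the approximate families, uniform in \<open>m\<close>\<close>
  have strong_bound: "Ns (hm m n) \<le> S" if mm: "m\<^sub>0 \<le> m" for m n
  proof -
    have m: "1 \<le> m" using m\<^sub>0[OF mm] by simp
    \<comment> \<open>For each single \<open>m\<close> this supremum is finite by equivariance;
      finiteness is what allows its multiples to be moved to the left-hand side later.\<close>
    define T where "T = (SUP n. Ns (hm m n))"
    have T: "Ns (hm m n) \<le> T" for n
      unfolding T_def by (rule cSUP_upper[OF UNIV_I hm_bdd[OF m]])
    have T0: "0 \<le> T" using T[of 0] Ns_ge0[OF hm_Bs[OF m, of 0]] by linarith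
    \<comment> \<open>A bound on the weak norm of \<open>hm m\<close>: that of \<open>h\<close> plus
      the gap estimate with \<open>S\<close> replaced by \<open>T\<close>.\<close>
    define E where "E = H + real k * (\<delta> m * ((lam + B) * T)) + C\<^sub>0 * (T + H) * exp (- \<gamma> * real k)"
    have "Ns (hm m n) \<le> lam * T + B * E" for n
    proof -
      \<comment> \<open>Writing each member as the image of its predecessor bounds it by
        \<open>T\<close> again, so taking the supremum yields an inequality for \<open>T\<close>
        alone.\<close>
      let ?i = "n - 1"
      have "hm m n = \<pi> m (L ?i (hm m ?i))" using hm_step[OF m, of ?i] by simp
      then have "Ns (hm m n) \<le> Ns (L ?i (hm m ?i))"
        using projections_strong_contraction[OF m L_Bs[OF hm_Bs[OF m]], of ?i ?i] by simp
      also have "\<dots> \<le> lam * Ns (hm m ?i) + B * Nw (hm m ?i)"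
        by (rule lasota_yorke[OF hm_Bs[OF m]])
      also have "\<dots> \<le> lam * T + B * E"
      proof -
        have d: "hm m ?i - h ?i \<in> Bw" "h ?i \<in> Bw"
          using hm_Bs[OF m] h_Bs inclusion Vw by (auto intro!: subspace_diff)
        have "Nw (hm m ?i - h ?i + h ?i) \<le> Nw (hm m ?i - h ?i) + Nw (h ?i)"
          using Nw d by (rule norm_on_triangle)
        then have "Nw (hm m ?i) \<le> E"
          using gap[OF m k(1) T, of ?i] weak_le_strong[OF h_Bs, of ?i] H[of ?i]
          unfolding E_def diff_add_cancel by linarith
        then show ?thesis
          using T[of ?i] lam_nonneg B_nonneg by (intro add_mono mult_left_mono)
      qed
      finally show ?thesis .
    qed
    then have "T \<le> lam * T + B * E" unfolding T_def by (intro cSUP_least) auto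
    also have "B * E = B * H + B * real k * (lam + B) * \<delta> m * T
        + B * C\<^sub>0 * exp (- \<gamma> * real k) * T + B * C\<^sub>0 * H * exp (- \<gamma> * real k)"
      unfolding E_def by (simp add: algebra_simps)
    finally have "T \<le> lam * T + (B * H + B * real k * (lam + B) * \<delta> m * T
        + B * C\<^sub>0 * exp (- \<gamma> * real k) * T + B * C\<^sub>0 * H * exp (- \<gamma> * real k))" .
    moreover have "B * real k * (lam + B) * \<delta> m * T \<le> (1 - lam) / 4 * T"
      using m\<^sub>0[OF mm] T0 by (intro mult_right_mono) auto
    moreover have "B * C\<^sub>0 * exp (- \<gamma> * real k) * T \<le> (1 - lam) / 4 * T"
      using k(2) T0 by (intro mult_right_mono) auto
    moreover have "B * C\<^sub>0 * H * exp (- \<gamma> * real k) \<le> B * C\<^sub>0 * H * 1"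
      using B_nonneg C\<^sub>0_ge_1 H0 \<gamma>_pos by (intro mult_left_mono) auto
    ultimately have "(1 - lam) * T \<le> 2 * (B * H + B * C\<^sub>0 * H)"
      by (simp add: algebra_simps)
    then have "T \<le> S"
      unfolding S_def using lam_less_1 by (simp add: field_simps)
    then show ?thesis using T[of n] by linarith
  qed

  \<comment> \<open>The rate, by optimising the number of steps\<close>
  define a where "a = (lam + B) * S"
  define b where "b = C\<^sub>0 * (S + H)"
  have a: "0 \<le> a" and b: "0 \<le> b"
    unfolding a_def b_def using lam_nonneg B_nonneg C\<^sub>0_ge_1 S0 H0 by auto
  have C: "0 \<le> a * (1 / \<gamma> + 1) + b" using a b \<gamma>_pos by simp
  \<comment> \<open>The extra 1 makes the constant positive from \<open>0 \<le> a\<close> and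
    \<open>0 \<le> b\<close> alone.\<close>
  have "(SUP n. ereal (Nw (hm m n - h n)))
      \<le> ereal ((a * (1 / \<gamma> + 1) + b + 1) * \<delta> m * \<bar>ln (\<delta> m)\<bar>)" if mm: "m\<^sub>0 \<le> m" for m
  proof (rule SUP_least)
    fix n
    have m: "1 \<le> m" and small: "\<delta> m \<le> exp (- 1)" using m\<^sub>0[OF mm] by auto
    have "Nw (hm m n - h n) \<le> (a * (1 / \<gamma> + 1) + b) * \<delta> m * \<bar>ln (\<delta> m)\<bar>"
      using gap[OF m _ strong_bound[OF mm], of _ n]
      by (intro le_mult_abs_ln[OF \<gamma>_pos a b \<delta>_nonneg[OF m] small]) (auto simp: a_def b_def)
    also have "\<dots> \<le> (a * (1 / \<gamma> + 1) + b + 1) * \<delta> m * \<bar>ln (\<delta> m)\<bar>"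
      using \<delta>_nonneg[OF m] by (intro mult_right_mono) auto
    finally show "ereal (Nw (hm m n - h n))
        \<le> ereal ((a * (1 / \<gamma> + 1) + b + 1) * \<delta> m * \<bar>ln (\<delta> m)\<bar>)" by simp
  qed
  moreover have "1 \<le> m\<^sub>0" using m\<^sub>0[of m\<^sub>0] by simp
  moreover have "0 < a * (1 / \<gamma> + 1) + b + 1" using C by linarith
  ultimately show ?thesis by blast
qed

end
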